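(* Let $d_{\mathrm{in}}, d_{\mathrm{out}}, r$ be positive integers with $r \le \min(d_{\mathrm{in}}, d_{\mathrm{out}})$, let $\boldsymbol{W}' \in \mathbb{R}^{d_{\mathrm{in}} \times d_{\mathrm{out}}}$ be a fixed matrix, let $\boldsymbol{A}_t \in \mathbb{R}^{d_{\mathrm{in}} \times r}$ be a fixed (frozen) matrix with $\boldsymbol{A}_t^\top \boldsymbol{A}_t = \boldsymbol{I}$, and let $\alpha > 0$ and $\eta > 0$ be real numbers. Let $\mathcal{L} : \mathbb{R}^{d_{\mathrm{in}} \times d_{\mathrm{out}}} \to \mathbb{R}$ be a differentiable loss function of the weight matrix $\boldsymbol{W}$. For $\boldsymbol{B}_t \in \mathbb{R}^{r \times d_{\mathrm{out}}}$ put $$\boldsymbol{W} = \boldsymbol{W}' + \frac{\alpha}{r}\boldsymbol{A}_t \boldsymbol{B}_t, \qquad \boldsymbol{G}_t = \nabla_{\boldsymbol{W}} \mathcal{L}(\boldsymbol{W}).$$ Then optimizing only $\boldsymbol{B}_t$ by gradient descent with learning rate $\eta$ is equivalent to performing gradient descent on $\boldsymbol{W}$ along the orthogonal projection of $\boldsymbol{G}_t$ onto $\mathrm{span}(\boldsymbol{A}_t)$. Precisely, at every $\boldsymbol{B}_t$, if $\Delta \boldsymbol{B}_t$ denotes the change of $\boldsymbol{B}_t$ in one gradient descent step with learning rate $\eta$ on the function $\boldsymbol{B}_t \mapsto \mathcal{L}(\boldsymbol{W}' + \frac{\alpha}{r}\boldsymbol{A}_t\boldsymbol{B}_t)$, then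 the resulting change of $\boldsymbol{W}$ is $$\Delta \boldsymbol{W} = \frac{\alpha}{r}\boldsymbol{A}_t \Delta \boldsymbol{B}_t = -c\, \boldsymbol{A}_t \boldsymbol{A}_t^\top \boldsymbol{G}_t, \qquad c = \frac{\eta \alpha^2}{r^2} > 0,$$ where $\boldsymbol{A}_t\boldsymbol{A}_t^\top \boldsymbol{G}_t$ is the orthogonal projection of $\boldsymbol{G}_t$ onto $\mathrm{span}(\boldsymbol{A}_t)$.
   Context: The gradient $\nabla_{\boldsymbol{W}}\mathcal{L}(\boldsymbol{W})$ of a real-valued function of a matrix is the matrix of the same shape as $\boldsymbol{W}$ whose entries are the partial derivatives with respect to the corresponding entries of $\boldsymbol{W}$ (equivalently, the gradient with respect to the Frobenius inner product). One gradient descent step with learning rate $\eta$ on a function $f$ changes its argument $\boldsymbol{B}$ by $\Delta \boldsymbol{B} = -\eta \nabla_{\boldsymbol{B}} f(\boldsymbol{B})$. $\mathrm{span}(\boldsymbol{A}_t) \subseteq \mathbb{R}^{d_{\mathrm{in}}}$ denotes the column space of $\boldsymbol{A}_t$, and the orthogonal projection of a matrix $\boldsymbol{G} \in \mathbb{R}^{d_{\mathrm{in}} \times d_{\mathrm{out}}}$ onto a subspace of $\mathbb{R}^{d_{\mathrm{in}}}$ means the orthogonal projection applied to each column of $\boldsymbol{G}$. *)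

theory Defs
  imports "HOL-Analysis.Analysis"
begin

(* axis i (axis j 1) is the matrix unit with its 1 in row i, column j, so the (i, j) entry below
   is the partial derivative of f with respect to the (i, j) entry of its argument. deriv takes an
   arbitrary value where the partial derivative does not exist. *)
definition matrix_gradient :: "(real^'n^'m \<Rightarrow> real) \<Rightarrow> real^'n^'m \<Rightarrow> real^'n^'m" where
  "matrix_gradient f X = (\<chi> i j. deriv (\<lambda>t. f (X + t *\<^sub>R axis i (axis j 1))) 0)"

(* The inner product on real^'n^'m is the Frobenius inner product. *)
lemma GDERIV_matrix_gradient:
  fixes f :: "real^'n^'m \<Rightarrow> real"
  assumes "f differentiable (at X)"
  shows "GDERIV f X :> matrix_gradient f X"
proof -
  obtain f' where f': "(f has_derivative f') (at X)"
    using assms by (auto simp: differentiable_def)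
  then interpret linear f' by (rule has_derivative_linear)
  have partial: "matrix_gradient f X $ i $ j = f' (axis i (axis j 1))" for i j
  proof -
    let ?E = "axis i (axis j 1) :: real^'n^'m"
    have "((\<lambda>t. X + t *\<^sub>R ?E) has_derivative (\<lambda>t. t *\<^sub>R ?E)) (at 0)"
      by (auto intro!: derivative_eq_intros)
    then have "((\<lambda>t. f (X + t *\<^sub>R ?E)) has_derivative (\<lambda>t. f' (t *\<^sub>R ?E))) (at 0)"
      by (rule has_derivative_compose) (simp add: f')
    then have "((\<lambda>t. f (X + t *\<^sub>R ?E)) has_field_derivative f' ?E) (at 0)"
      by (simp add: has_field_derivative_def scale mult.commute[of _ "f' ?E"])
    then show ?thesis
      by (simp add: matrix_gradient_def DERIV_imp_deriv)
  qed
  have "f' H = inner H (matrix_gradient f X)" for H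
  proof -
    have "H = (\<Sum>i\<in>UNIV. \<Sum>j\<in>UNIV. (H $ i $ j) *\<^sub>R axis i (axis j 1))"
    proof -
      have "(\<Sum>k\<in>UNIV. \<Sum>l\<in>UNIV. if i = k then if j = l then H $ k $ l else 0 else 0) = H $ i $ j"
        for i j
      proof -
        have "(\<Sum>l\<in>UNIV. if i = k then if j = l then H $ k $ l else 0 else 0)
            = (if i = k then H $ k $ j else 0)" for k
          by simp
        then show ?thesis
          by simp
      qed
      then show ?thesis
        by (simp add: vec_eq_iff axis_def if_distrib [of "\<lambda>v. v $ _"] if_distrib [of "(*) _"]
            cong: if_cong)
    qed
    then have "f' H = f' (\<Sum>i\<in>UNIV. \<Sum>j\<in>UNIV. (H $ i $ j) *\<^sub>R axis i (axis j 1))"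
      by (rule arg_cong)
    also have "\<dots> = (\<Sum>i\<in>UNIV. \<Sum>j\<in>UNIV. H $ i $ j * f' (axis i (axis j 1)))"
      by (simp add: sum scale)
    finally show ?thesis
      by (simp add: inner_vec_def partial)
  qed
  then have "f' = (\<lambda>H. inner H (matrix_gradient f X))"
    by (rule ext)
  with f' show ?thesis
    by (simp add: gderiv_def)
qed

definition gd_change :: "real \<Rightarrow> (real^'n^'m \<Rightarrow> real) \<Rightarrow> real^'n^'m \<Rightarrow> real^'n^'m" where
  "gd_change \<eta> f X = - \<eta> *\<^sub>R matrix_gradient f X"

definition column_space :: "real^'n^'m \<Rightarrow> (real^'m) set" where
  "column_space A = span (columns A)"

(* For a subspace S of a Euclidean space such a p exists and is unique. *)
definition orthogonal_projection :: "'a::real_inner set \<Rightarrow> 'a \<Rightarrow> 'a" where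
  "orthogonal_projection S x = (THE p. p \<in> S \<and> x - p \<in> S\<^sup>\<bottom>)"

definition columnwise_projection :: "(real^'m) set \<Rightarrow> real^'n^'m \<Rightarrow> real^'n^'m" where
  "columnwise_projection S G = (\<chi> i j. orthogonal_projection S (column j G) $ i)"

end

theory Submission
  imports Defs
begin

text \<open>For the Frobenius inner product, left multiplication by \<open>A\<close> has left
  multiplication by \<open>transpose A\<close> as its adjoint
  (\<open>inner_matrix_mult_left\<close>). As the weight is affine in \<open>B\<close> with linear
  part \<open>(\<alpha> / r) *\<^sub>R (A ** H)\<close>, the chain rule gives the gradient in
  \<open>B\<close> as \<alpha>/r times \<open>transpose A ** G\<close>
  (\<open>matrix_gradient_affine\<close>). Mapping the step on \<open>B\<close> back to weights
  multiplies by \<open>A\<close> and by \<alpha>/r once more, which yields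
  \<open>A ** transpose A ** G\<close> and the square in \<open>c\<close>. Orthonormality of the
  columns of \<open>A\<close> makes \<open>A ** transpose A\<close> the orthogonal projector onto
  the column space (\<open>orthogonal_projection_column_space\<close>).\<close>

lemma inner_matrix_mult_left:
  fixes A :: "real^'r^'m" and H :: "real^'n^'r" and G :: "real^'n^'m"
  shows "inner (A ** H) G = inner H (transpose A ** G)"
proof -
  \<comment> \<open>Both sides are the same triple sum; swapping adjacent sums turns the order i, j,
    k into k, j, i.\<close>
  have "inner (A ** H) G = (\<Sum>i\<in>UNIV. \<Sum>j\<in>UNIV. \<Sum>k\<in>UNIV. A $ i $ k * H $ k $ j * G $ i $ j)"
    by (simp add: inner_vec_def matrix_matrix_mult_def sum_distrib_right)
  also have "\<dots> = (\<Sum>i\<in>UNIV. \<Sum>k\<in>UNIV. \<Sum>j\<in>UNIV. A $ i $ k * H $ k $ j * G $ i $ j)"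
    by (intro sum.cong refl sum.swap)
  also have "\<dots> = (\<Sum>k\<in>UNIV. \<Sum>i\<in>UNIV. \<Sum>j\<in>UNIV. A $ i $ k * H $ k $ j * G $ i $ j)"
    by (rule sum.swap)
  also have "\<dots> = (\<Sum>k\<in>UNIV. \<Sum>j\<in>UNIV. \<Sum>i\<in>UNIV. A $ i $ k * H $ k $ j * G $ i $ j)"
    by (intro sum.cong refl sum.swap)
  also have "\<dots> = inner H (transpose A ** G)"
    by (simp add: inner_vec_def matrix_matrix_mult_def transpose_def sum_distrib_left ac_simps)
  finally show ?thesis .
qed

lemma bounded_linear_matrix_mult_right:
  fixes A :: "real^'r^'m"
  shows "bounded_linear (\<lambda>H :: real^'n^'r. A ** H)"
  by (intro linear_conv_bounded_linear[THEN iffD1] linearI)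
     (simp_all add: matrix_add_ldistrib matrix_scalar_ac scalar_matrix_assoc)

text \<open>Uniqueness of the Frechet derivative: a gradient can be found from the chain rule,
  without touching the partial derivatives that define it.\<close>

lemma matrix_gradient_eqI:
  fixes f :: "real^'n^'m \<Rightarrow> real"
  assumes "GDERIV f X :> D"
  shows "matrix_gradient f X = D"
proof -
  have "f differentiable (at X)"
    using assms by (auto simp: gderiv_def differentiable_def)
  then have "GDERIV f X :> matrix_gradient f X"
    by (rule GDERIV_matrix_gradient)
  with assms have "(\<lambda>h. inner h (matrix_gradient f X)) = (\<lambda>h. inner h D)"
    unfolding gderiv_def by (intro has_derivative_unique)
  then show ?thesis
    by (metis vector_eq_ldot)
qed

text \<open>The chain rule gives the derivative \<open>inner (k *\<^sub>R (A ** H)) G\<close> in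
  direction \<open>H\<close>, with \<open>G\<close> the gradient at the weight; the adjoint then
  moves \<open>A\<close> to the other side.\<close>

lemma matrix_gradient_affine:
  fixes f :: "real^'n^'m \<Rightarrow> real" and A :: "real^'r^'m"
  assumes "f differentiable (at (W + k *\<^sub>R (A ** B)))"
  shows "matrix_gradient (\<lambda>B. f (W + k *\<^sub>R (A ** B))) B
       = k *\<^sub>R (transpose A ** matrix_gradient f (W + k *\<^sub>R (A ** B)))"
proof (rule matrix_gradient_eqI)
  let ?G = "matrix_gradient f (W + k *\<^sub>R (A ** B))"
  have "((\<lambda>B. W + k *\<^sub>R (A ** B)) has_derivative (\<lambda>H. k *\<^sub>R (A ** H))) (at B)"
    by (auto intro!: derivative_eq_intros
        bounded_linear.has_derivative[OF bounded_linear_matrix_mult_right])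
  moreover have "(f has_derivative (\<lambda>H. inner H ?G)) (at (W + k *\<^sub>R (A ** B)))"
    using GDERIV_matrix_gradient[OF assms] by (simp add: gderiv_def)
  ultimately have "((\<lambda>B. f (W + k *\<^sub>R (A ** B))) has_derivative
      (\<lambda>H. inner (k *\<^sub>R (A ** H)) ?G)) (at B)"
    by (rule has_derivative_compose)
  then show "GDERIV (\<lambda>B. f (W + k *\<^sub>R (A ** B))) B :> k *\<^sub>R (transpose A ** ?G)"
    by (simp add: gderiv_def inner_matrix_mult_left)
qed

text \<open>Two candidates differ by a vector that lies both in \<open>S\<close> and in its
  orthogonal complement, hence is zero; this settles the definite description.\<close>

lemma orthogonal_projection_eqI:
  fixes S :: "'a::real_inner set"
  assumes "subspace S" "p \<in> S" "x - p \<in> S\<^sup>\<bottom>"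
  shows "orthogonal_projection S x = p"
  unfolding orthogonal_projection_def
proof (rule the_equality)
  fix q assume q: "q \<in> S \<and> x - q \<in> S\<^sup>\<bottom>"
  \<comment> \<open>This difference is \<open>q - p\<close>.\<close>
  have "(x - p) - (x - q) \<in> S\<^sup>\<bottom>"
    using q assms(3) subspace_orthogonal_comp subspace_diff by blast
  moreover have "q - p \<in> S"
    using q assms subspace_diff by blast
  ultimately have "inner (q - p) (q - p) = 0"
    by (auto simp: orthogonal_comp_def orthogonal_def)
  then show "q = p" by simp
qed (use assms in simp)

text \<open>The residual \<open>x - (A ** transpose A) *v x\<close> is killed by
  \<open>transpose A\<close>, because \<open>transpose A ** A\<close> is the identity, and the
  kernel of \<open>transpose A\<close> is orthogonal to the range of \<open>A\<close>.\<close>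

lemma orthogonal_projection_column_space:
  fixes A :: "real^'r^'m"
  assumes "transpose A ** A = mat 1"
  shows "orthogonal_projection (column_space A) x = (A ** transpose A) *v x"
proof (rule orthogonal_projection_eqI)
  show "subspace (column_space A)"
    by (simp add: column_space_def)
  \<comment> \<open>Writing members of the span as \<open>A *v y\<close> lets \<open>A\<close> be
    moved across the inner product below.\<close>
  have range: "column_space A = range ((*v) A)"
  proof
    show "column_space A \<subseteq> range ((*v) A)"
      unfolding column_space_def
    proof (rule span_minimal)
      show "columns A \<subseteq> range ((*v) A)"
        by (auto simp: columns_def simp flip: matrix_vector_mult_basis)
      show "subspace (range ((*v) A))"
        by (simp add: linear_subspace_image)
    qed
    show "range ((*v) A) \<subseteq> column_space A"
      unfolding column_space_def using matrix_vector_mult_in_columnspace by blast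
  qed
  show "(A ** transpose A) *v x \<in> column_space A"
    by (simp add: range flip: matrix_vector_mul_assoc)
  have "transpose A *v (x - (A ** transpose A) *v x) = 0"
    by (simp add: matrix_vector_mult_diff_distrib matrix_vector_mul_assoc matrix_mul_assoc assms)
  then show "x - (A ** transpose A) *v x \<in> (column_space A)\<^sup>\<bottom>"
    using dot_lmul_matrix[of _ "transpose A"]
    by (auto simp: orthogonal_comp_def orthogonal_def range vector_transpose_matrix)
qed

theorem proposition1:
  fixes W' :: "real^'dout^'din"
    and A :: "real^'r^'din"
    and \<L> :: "real^'dout^'din \<Rightarrow> real"
    and \<alpha> \<eta> :: real
    and B :: "real^'dout^'r"
  assumes "CARD('r) \<le> min CARD('din) CARD('dout)"
    and "transpose A ** A = mat 1"
    and "\<alpha> > 0" and "\<eta> > 0"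
    and "\<forall>X. \<L> differentiable (at X)"
  shows
    "let r = real CARD('r);
         weight = (\<lambda>B :: real^'dout^'r. W' + (\<alpha> / r) *\<^sub>R (A ** B));
         G = matrix_gradient \<L> (weight B);
         \<Delta>B = gd_change \<eta> (\<lambda>B. \<L> (weight B)) B;
         \<Delta>W = weight (B + \<Delta>B) - weight B;
         c = \<eta> * \<alpha>\<^sup>2 / r\<^sup>2
     in c > 0
        \<and> \<Delta>W = (\<alpha> / r) *\<^sub>R (A ** \<Delta>B)
        \<and> \<Delta>W = - c *\<^sub>R (A ** transpose A ** G)
        \<and> A ** transpose A ** G = columnwise_projection (column_space A) G"
proof -
  define r where "r = real CARD('r)"
  define weight where "weight = (\<lambda>B :: real^'dout^'r. W' + (\<alpha> / r) *\<^sub>R (A ** B))"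
  define G where "G = matrix_gradient \<L> (weight B)"
  define \<Delta>B where "\<Delta>B = gd_change \<eta> (\<lambda>B. \<L> (weight B)) B"
  have "r > 0"
    by (simp add: r_def)
  then have c_pos: "\<eta> * \<alpha>\<^sup>2 / r\<^sup>2 > 0"
    using assms by simp
  \<comment> \<open>Exact rather than first order, since \<open>weight\<close> is affine.\<close>
  have change: "weight (B + \<Delta>B) - weight B = (\<alpha> / r) *\<^sub>R (A ** \<Delta>B)"
    by (simp add: weight_def matrix_add_ldistrib scaleR_add_right)
  \<comment> \<open>This factor \<alpha>/r comes from the chain rule; the second one, in
    \<open>step\<close>, comes from the scaling in \<open>weight\<close>.\<close>
  have "\<Delta>B = - (\<eta> * (\<alpha> / r)) *\<^sub>R (transpose A ** G)"
    using assms by (simp add: \<Delta>B_def gd_change_def G_def weight_def matrix_gradient_affine)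
  then have "A ** \<Delta>B = - (\<eta> * (\<alpha> / r)) *\<^sub>R (A ** transpose A ** G)"
    by (simp only: linear_cmul[OF bounded_linear.linear[OF bounded_linear_matrix_mult_right]]
        matrix_mul_assoc)
  then have step: "(\<alpha> / r) *\<^sub>R (A ** \<Delta>B) = - (\<eta> * \<alpha>\<^sup>2 / r\<^sup>2) *\<^sub>R (A ** transpose A ** G)"
    by (simp add: power2_eq_square mult_ac)
  \<comment> \<open>Column j of a product \<open>M ** G\<close> is \<open>M\<close> applied to
    column j of \<open>G\<close>, so the vector projection formula applies to each column.\<close>
  have "A ** transpose A ** G = columnwise_projection (column_space A) G"
    by (simp add: columnwise_projection_def orthogonal_projection_column_space[OF assms(2)]
        vec_eq_iff matrix_matrix_mult_def[of _ G] matrix_vector_mult_def column_def)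
  with c_pos change step show ?thesis
    unfolding Let_def G_def \<Delta>B_def weight_def r_def by presburger
qed

end
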